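(* The one-dimensional all-topology two-fluid system described in the context (seven equations for seven scalar unknowns) admits real eigenvalues, which are $u$, $u_k$ and $u_k\pm c_k$ with $k=1,2$, where $c_k=\sqrt{\left.\partial p_k/\partial\rho_k\right|_{s_k}}$ denotes the sound velocity of phase $k$. The corresponding eigenvectors span $\mathbb{R}^7$, and the system is hyperbolic, under the non-resonance condition $u\neq u_k\pm c_k$ for $k=1,2$ (both signs).
   Context: Thermodynamics: for each phase $k=1,2$ a complete equation of state is given by a smooth strictly concave function $(\tau_k,e_k)\mapsto s_k$, where $\rho_k>0$ is the density, $\tau_k=1/\rho_k$ the specific volume, $e_k$ the specific internal energy and $s_k$ the specific entropy. The Gibbs identity $T_k\,\mathrm{d}s_k=\mathrm{d}e_k+p_k\,\mathrm{d}\tau_k$ defines the temperature $T_k>0$ and the pressure $p_k$. The derivative $\left.\partial p_k/\partial\rho_k\right|_{s_k}$ is positive and $c_k>0$. Notation: $u_k\in\mathbb{R}$ is the velocity of phase $k$; $\alpha_1\in(0,1)$ is the volume fraction of phase 1 and $\alpha_2=1-\alpha_1$; $\rho=\alpha_1\rho_1+\alpha_2\rho_2$; $Y_k=\alpha_k\rho_k/\rho$; $u=Y_1u_1+Y_2u_2$; $E_k=e_k+u_k^2/2$; $H_k=E_k+p_k/\rho_k$; interfacial pressure $p_I=Y_2p_1+Y_1p_2$; interfacial work $(pu)_I=Y_1p_2u_1+Y_2p_1u_2$. System (one space dimension, no source terms): $$\partial_t\alpha_1+u\,\partial_x\alpha_1=0,$$ $$\partial_t(\alpha_k\rho_k)+\partial_x(\alpha_k\rho_ku_k)=0,\quad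 k=1,2,$$ $$\partial_t(\alpha_1\rho_1u_1)+\partial_x(\alpha_1\rho_1u_1^2+\alpha_1p_1)-p_I\partial_x\alpha_1=0,$$ $$\partial_t(\alpha_2\rho_2u_2)+\partial_x(\alpha_2\rho_2u_2^2+\alpha_2p_2)+p_I\partial_x\alpha_1=0,$$ $$\partial_t(\alpha_1\rho_1E_1)+\partial_x(\alpha_1\rho_1H_1u_1)-(pu)_I\partial_x\alpha_1=0,$$ $$\partial_t(\alpha_2\rho_2E_2)+\partial_x(\alpha_2\rho_2H_2u_2)+(pu)_I\partial_x\alpha_1=0.$$ Eigenvalues and eigenvectors are those of the $7\times7$ matrix $\mathbf{A}$ of the quasilinear form $\partial_t\boldsymbol{Q}+\mathbf{A}(\boldsymbol{Q})\partial_x\boldsymbol{Q}=\boldsymbol{0}$, for smooth solutions, in any set of seven independent state variables, e.g. $\boldsymbol{Q}=(\alpha_1,\alpha_1\rho_1,\alpha_2\rho_2,\alpha_1\rho_1u_1,\alpha_2\rho_2u_2,\alpha_1\rho_1E_1,\alpha_2\rho_2E_2)$ or $(\alpha_1,u_1,p_1,s_1,u_2,p_2,s_2)$; changing variables conjugates $\mathbf{A}$ and transforms eigenvectors by the Jacobian. The system is hyperbolic at a state if $\mathbf{A}$ is diagonalizable over $\mathbb{R}$ there. *)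

theory Defs
  imports "HOL-Analysis.Analysis"
begin

section \<open>Smoothness and strict concavity\<close>

primrec times_cont_diff ::
  "nat \<Rightarrow> 'a set \<Rightarrow> ('a::real_normed_vector \<Rightarrow> 'b::real_normed_vector) \<Rightarrow> bool" where
  "times_cont_diff 0 S f \<longleftrightarrow> continuous_on S f"
| "times_cont_diff (Suc n) S f \<longleftrightarrow> f differentiable_on S \<and>
     (\<forall>v. times_cont_diff n S (\<lambda>x. frechet_derivative f (at x) v))"

text \<open>Only used for open \<open>S\<close> in finite-dimensional spaces, where it is the usual
  notion of a function of class \<open>C\<close>-infinity.\<close>

definition smooth_on ::
  "'a set \<Rightarrow> ('a::real_normed_vector \<Rightarrow> 'b::real_normed_vector) \<Rightarrow> bool" where
  "smooth_on S f \<longleftrightarrow> (\<forall>n. times_cont_diff n S f)"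

definition strictly_concave_on :: "'a::real_vector set \<Rightarrow> ('a \<Rightarrow> real) \<Rightarrow> bool" where
  "strictly_concave_on S f \<longleftrightarrow> convex S \<and>
     (\<forall>x\<in>S. \<forall>y\<in>S. \<forall>\<theta>. x \<noteq> y \<and> 0 < \<theta> \<and> \<theta> < 1 \<longrightarrow>
        f ((1 - \<theta>) *\<^sub>R x + \<theta> *\<^sub>R y) > (1 - \<theta>) * f x + \<theta> * f y)"

section \<open>Thermodynamics of one phase\<close>

text \<open>Thermodynamic functions take the pair (specific volume, specific internal energy).
  \<open>isentropic_pressure U s p \<sigma> r\<close> is the pressure as a function of the entropy \<open>\<sigma>\<close> and the
  density \<open>r\<close>; the energy selected by \<open>THE\<close> is unique when the temperature is positive on
  the convex set \<open>U\<close>, since \<open>s\<close> then increases with the energy.\<close>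

definition isentropic_pressure ::
  "(real \<times> real) set \<Rightarrow> (real \<times> real \<Rightarrow> real) \<Rightarrow> (real \<times> real \<Rightarrow> real) \<Rightarrow> real \<Rightarrow> real \<Rightarrow> real" where
  "isentropic_pressure U s p \<sigma> r = p (1 / r, THE e. (1 / r, e) \<in> U \<and> s (1 / r, e) = \<sigma>)"

definition dp_drho_at_constant_entropy ::
  "(real \<times> real) set \<Rightarrow> (real \<times> real \<Rightarrow> real) \<Rightarrow> (real \<times> real \<Rightarrow> real) \<Rightarrow> real \<times> real \<Rightarrow> real" where
  "dp_drho_at_constant_entropy U s p x = deriv (isentropic_pressure U s p (s x)) (1 / fst x)"

text \<open>A complete equation of state \<open>s\<close> on \<open>U\<close>, with the temperature \<open>T\<close> and the pressure \<open>p\<close>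
  that the Gibbs identity \<open>T ds = de + p d\<tau>\<close> determines on \<open>U\<close>.\<close>

definition complete_eos ::
  "(real \<times> real) set \<Rightarrow> (real \<times> real \<Rightarrow> real) \<Rightarrow> (real \<times> real \<Rightarrow> real) \<Rightarrow> (real \<times> real \<Rightarrow> real) \<Rightarrow> bool" where
  "complete_eos U s T p \<longleftrightarrow>
     open U \<and> (\<forall>x\<in>U. fst x > 0) \<and> smooth_on U s \<and> strictly_concave_on U s \<and>
     (\<forall>x\<in>U. T x > 0) \<and>
     (\<forall>x\<in>U. \<forall>d\<tau> de. T x * frechet_derivative s (at x) (d\<tau>, de) = de + p x * d\<tau>) \<and>
     (\<forall>x\<in>U. dp_drho_at_constant_entropy U s p x > 0)"

section \<open>States of the two-phase mixture\<close>

datatype phase = Ph1 | Ph2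

text \<open>A physical state is the vector \<open>(\<alpha>\<^sub>1, \<rho>\<^sub>1, \<rho>\<^sub>2, u\<^sub>1, u\<^sub>2, e\<^sub>1, e\<^sub>2)\<close>.\<close>

type_synonym state = "real ^ 7"

fun vol_frac :: "phase \<Rightarrow> state \<Rightarrow> real" where
  "vol_frac Ph1 V = V $ 1"
| "vol_frac Ph2 V = 1 - V $ 1"

fun density :: "phase \<Rightarrow> state \<Rightarrow> real" where
  "density Ph1 V = V $ 2"
| "density Ph2 V = V $ 3"

fun velocity :: "phase \<Rightarrow> state \<Rightarrow> real" where
  "velocity Ph1 V = V $ 4"
| "velocity Ph2 V = V $ 5"

fun int_energy :: "phase \<Rightarrow> state \<Rightarrow> real" where
  "int_energy Ph1 V = V $ 6"
| "int_energy Ph2 V = V $ 7"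

definition thermo :: "phase \<Rightarrow> state \<Rightarrow> real \<times> real" where
  "thermo k V = (1 / density k V, int_energy k V)"

definition part_density :: "phase \<Rightarrow> state \<Rightarrow> real" where
  "part_density k V = vol_frac k V * density k V"

definition mix_density :: "state \<Rightarrow> real" where
  "mix_density V = part_density Ph1 V + part_density Ph2 V"

definition mass_frac :: "phase \<Rightarrow> state \<Rightarrow> real" where
  "mass_frac k V = part_density k V / mix_density V"

definition mix_velocity :: "state \<Rightarrow> real" where
  "mix_velocity V = mass_frac Ph1 V * velocity Ph1 V + mass_frac Ph2 V * velocity Ph2 V"

definition total_energy :: "phase \<Rightarrow> state \<Rightarrow> real" where
  "total_energy k V = int_energy k V + (velocity k V)\<^sup>2 / 2"

definition pressure :: "(phase \<Rightarrow> real \<times> real \<Rightarrow> real) \<Rightarrow> phase \<Rightarrow> state \<Rightarrow> real" where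
  "pressure p k V = p k (thermo k V)"

definition total_enthalpy :: "(phase \<Rightarrow> real \<times> real \<Rightarrow> real) \<Rightarrow> phase \<Rightarrow> state \<Rightarrow> real" where
  "total_enthalpy p k V = total_energy k V + pressure p k V / density k V"

definition interface_pressure :: "(phase \<Rightarrow> real \<times> real \<Rightarrow> real) \<Rightarrow> state \<Rightarrow> real" where
  "interface_pressure p V =
     mass_frac Ph2 V * pressure p Ph1 V + mass_frac Ph1 V * pressure p Ph2 V"

definition interface_work :: "(phase \<Rightarrow> real \<times> real \<Rightarrow> real) \<Rightarrow> state \<Rightarrow> real" where
  "interface_work p V =
     mass_frac Ph1 V * pressure p Ph2 V * velocity Ph1 V +
     mass_frac Ph2 V * pressure p Ph1 V * velocity Ph2 V"

definition sound_speed ::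
  "(phase \<Rightarrow> (real \<times> real) set) \<Rightarrow> (phase \<Rightarrow> real \<times> real \<Rightarrow> real) \<Rightarrow>
   (phase \<Rightarrow> real \<times> real \<Rightarrow> real) \<Rightarrow> phase \<Rightarrow> state \<Rightarrow> real" where
  "sound_speed U s p k V = sqrt (dp_drho_at_constant_entropy (U k) (s k) (p k) (thermo k V))"

definition admissible_states :: "(phase \<Rightarrow> (real \<times> real) set) \<Rightarrow> state set" where
  "admissible_states U =
     {V. 0 < vol_frac Ph1 V \<and> vol_frac Ph1 V < 1 \<and> (\<forall>k. density k V > 0 \<and> thermo k V \<in> U k)}"

section \<open>The two-fluid system and its quasilinear form\<close>

text \<open>Fields are functions of the pair (time, position).\<close>

definition Dt :: "(real \<times> real \<Rightarrow> 'a::real_normed_vector) \<Rightarrow> real \<times> real \<Rightarrow> 'a" where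
  "Dt f z = frechet_derivative f (at z) (1, 0)"

definition Dx :: "(real \<times> real \<Rightarrow> 'a::real_normed_vector) \<Rightarrow> real \<times> real \<Rightarrow> 'a" where
  "Dx f z = frechet_derivative f (at z) (0, 1)"

definition two_fluid_system_at ::
  "(phase \<Rightarrow> real \<times> real \<Rightarrow> real) \<Rightarrow> (real \<times> real \<Rightarrow> state) \<Rightarrow> real \<times> real \<Rightarrow> bool" where
  "two_fluid_system_at p V z \<longleftrightarrow>
     (let \<alpha> = (\<lambda>k z. vol_frac k (V z)); m = (\<lambda>k z. part_density k (V z));
          u = (\<lambda>k z. velocity k (V z)); P = (\<lambda>k z. pressure p k (V z));
          E = (\<lambda>k z. total_energy k (V z)); H = (\<lambda>k z. total_enthalpy p k (V z));
          pI = interface_pressure p (V z); puI = interface_work p (V z)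
      in
        Dt (\<alpha> Ph1) z + mix_velocity (V z) * Dx (\<alpha> Ph1) z = 0 \<and>
        (\<forall>k. Dt (m k) z + Dx (\<lambda>z. m k z * u k z) z = 0) \<and>
        Dt (\<lambda>z. m Ph1 z * u Ph1 z) z
          + Dx (\<lambda>z. m Ph1 z * (u Ph1 z)\<^sup>2 + \<alpha> Ph1 z * P Ph1 z) z - pI * Dx (\<alpha> Ph1) z = 0 \<and>
        Dt (\<lambda>z. m Ph2 z * u Ph2 z) z
          + Dx (\<lambda>z. m Ph2 z * (u Ph2 z)\<^sup>2 + \<alpha> Ph2 z * P Ph2 z) z + pI * Dx (\<alpha> Ph1) z = 0 \<and>
        Dt (\<lambda>z. m Ph1 z * E Ph1 z) z
          + Dx (\<lambda>z. m Ph1 z * H Ph1 z * u Ph1 z) z - puI * Dx (\<alpha> Ph1) z = 0 \<and>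
        Dt (\<lambda>z. m Ph2 z * E Ph2 z) z
          + Dx (\<lambda>z. m Ph2 z * H Ph2 z * u Ph2 z) z + puI * Dx (\<alpha> Ph1) z = 0)"

text \<open>A set of seven independent state variables: coordinates \<open>w\<close>, ranging over \<open>W\<close>, of the
  admissible states \<open>\<Phi> w\<close>. Besides the identity, this covers the conservative variables and
  \<open>(\<alpha>\<^sub>1, u\<^sub>1, p\<^sub>1, s\<^sub>1, u\<^sub>2, p\<^sub>2, s\<^sub>2)\<close> near any state.\<close>

definition state_variables ::
  "(phase \<Rightarrow> (real \<times> real) set) \<Rightarrow> (real ^ 7) set \<Rightarrow> (real ^ 7 \<Rightarrow> state) \<Rightarrow> bool" where
  "state_variables U W \<Phi> \<longleftrightarrow>
     open W \<and> \<Phi> ` W \<subseteq> admissible_states U \<and> smooth_on W \<Phi> \<and> inj_on \<Phi> W \<and>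
     (\<forall>w\<in>W. invertible (jacobian \<Phi> (at w)))"

text \<open>\<open>A\<close> is the value at \<open>w\<close> of the matrix of the quasilinear form: at a point where a smooth
  field takes the value \<open>w\<close>, the system is equivalent to \<open>\<partial>\<^sub>t q + A \<partial>\<^sub>x q = 0\<close>. The equivalence is
  required pointwise, not only for fields solving the system on a whole region; as the
  derivative \<open>\<partial>\<^sub>x q\<close> at the point is arbitrary, this determines \<open>A\<close>.\<close>

definition quasilinear_matrix ::
  "(phase \<Rightarrow> real \<times> real \<Rightarrow> real) \<Rightarrow> (real ^ 7) set \<Rightarrow> (real ^ 7 \<Rightarrow> state) \<Rightarrow> real ^ 7 \<Rightarrow>
   real ^ 7 ^ 7 \<Rightarrow> bool" where
  "quasilinear_matrix p W \<Phi> w A \<longleftrightarrow>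
     (\<forall>\<Omega> q z. open \<Omega> \<and> z \<in> \<Omega> \<and> smooth_on \<Omega> q \<and> q ` \<Omega> \<subseteq> W \<and> q z = w \<longrightarrow>
        (two_fluid_system_at p (\<Phi> \<circ> q) z \<longleftrightarrow> Dt q z + A *v Dx q z = 0))"

section \<open>Eigenvalues, eigenvectors and hyperbolicity\<close>

definition eigenvector :: "'a::field ^ 'n ^ 'n \<Rightarrow> 'a ^ 'n \<Rightarrow> 'a \<Rightarrow> bool" where
  "eigenvector A v l \<longleftrightarrow> v \<noteq> 0 \<and> A *v v = l *s v"

definition eigenvalues :: "'a::field ^ 'n ^ 'n \<Rightarrow> 'a set" where
  "eigenvalues A = {l. \<exists>v. eigenvector A v l}"

definition diagonalizable :: "'a::field ^ 'n ^ 'n \<Rightarrow> bool" where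
  "diagonalizable A \<longleftrightarrow>
     (\<exists>P D :: 'a ^ 'n ^ 'n. invertible P \<and> (\<forall>i j. i \<noteq> j \<longrightarrow> D $ i $ j = 0) \<and> A = P ** D ** matrix_inv P)"

end

(* In the variables (alpha_1, rho_k, u_k, e_k) the system is V_t + B V_x = 0, where B is block
   triangular: the equation for alpha_1 decouples, and each phase evolves by its own Euler system
   with a source proportional to the gradient of alpha_1. The acoustic and entropy waves of the
   two phases together with the alpha_1-axis always form a basis, in which B is diagonal apart
   from the column of alpha_1. Since p_I u_k - (pu)_I = p_k (u_k - u), that column has no entropy
   components, so u = u_k is harmless and only u = u_k +- c_k obstructs the diagonalization.
   Other state variables conjugate B by the Jacobian. *)

theory Submission
  imports Defs
begin

text \<open>Speeds of different phases may coincide, and u may equal u_k, so an argument from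
  distinct eigenvalues fails and an explicit basis is used. The determinant of an arrow matrix is
  the product of its diagonal, which gives the spectrum even at resonance; each entry of its column
  is removed separately, which localizes the obstruction. The entropy entries vanish because the
  source perturbs density and energy in the ratio de = (p / \<rho>^2) d\<rho>, which by the Gibbs
  identity means ds = 0. On the thermodynamic side, the pressure is known only through the Gibbs
  identity, and its isentropic derivative through an implicitly defined energy, so both are
  recovered from the smoothness of the entropy.\<close>

section \<open>Arrow matrices\<close>

definition arrow_matrix :: "'n \<Rightarrow> ('n \<Rightarrow> 'a::field) \<Rightarrow> ('n \<Rightarrow> 'a) \<Rightarrow> 'a ^ 'n ^ 'n" where
  "arrow_matrix j d n = (\<chi> i k. if i = k then d i else if k = j then n i else 0)"

lemma arrow_matrix_mult_vec:
  "(arrow_matrix j d n *v x) $ i = d i * x $ i + (if i = j then 0 else n i * x $ j)"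
proof -
  have "(arrow_matrix j d n *v x) $ i =
    (\<Sum>k\<in>UNIV. (if k = i then d i * x $ i else 0) + (if k = j then (if i = j then 0 else n i * x $ j) else 0))"
    unfolding arrow_matrix_def matrix_vector_mult_def vec_lambda_beta by (intro sum.cong) auto
  then show ?thesis
    by (simp add: sum.distrib)
qed

text \<open>A permutation other than the identity moves some index to an index other than \<open>j\<close>: if it
  moves \<open>i\<close> to \<open>j\<close>, then by injectivity it moves \<open>j\<close> elsewhere. So only the identity
  contributes to the determinant.\<close>

lemma det_arrow_matrix: "det (arrow_matrix j d n) = (\<Prod>i\<in>UNIV. d i)"
proof -
  let ?M = "arrow_matrix j d n"
  let ?f = "\<lambda>\<pi>. of_int (sign \<pi>) * (\<Prod>i\<in>UNIV. ?M $ i $ \<pi> i)"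
  have zero: "?f \<pi> = 0" if "\<pi> permutes UNIV" "\<pi> \<noteq> id" for \<pi>
  proof -
    obtain i where i: "\<pi> i \<noteq> i"
      using \<open>\<pi> \<noteq> id\<close> by (auto simp: fun_eq_iff)
    have "\<exists>i. \<pi> i \<noteq> i \<and> \<pi> i \<noteq> j"
    proof (cases "\<pi> i = j")
      case True
      then have "\<pi> j \<noteq> j"
        using i permutes_inj[OF that(1)] by (metis injD)
      then show ?thesis
        by blast
    qed (use i in blast)
    then obtain i where "\<pi> i \<noteq> i" "\<pi> i \<noteq> j"
      by blast
    then have "?M $ i $ \<pi> i = 0"
      by (simp add: arrow_matrix_def)
    then show ?thesis
      by (auto simp: prod_zero_iff)
  qed
  have "det ?M = sum ?f {id}"
    unfolding det_def by (rule sum.mono_neutral_right) (auto simp: permutes_id zero)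
  then show ?thesis
    by (simp add: sign_id arrow_matrix_def)
qed

section \<open>Similarity, characteristic polynomials and diagonalization\<close>

lemma mat_minus_arrow_matrix:
  "mat l - arrow_matrix j d n = arrow_matrix j (\<lambda>i. l - d i) (\<lambda>i. - n i)"
  by (simp add: arrow_matrix_def mat_def vec_eq_iff)

lemma matrix_inv_inverse:
  fixes P :: "'a::field ^ 'n ^ 'n"
  assumes "invertible P"
  shows "P ** matrix_inv P = mat 1" "matrix_inv P ** P = mat 1"
  using assms someI_ex[of "\<lambda>A'. P ** A' = mat 1 \<and> A' ** P = mat 1"]
  unfolding invertible_def matrix_inv_def by auto

lemma mat_mult_commute:
  fixes P :: "'a::field ^ 'n ^ 'n"
  shows "mat l ** P = P ** mat l"
  by (simp add: matrix_matrix_mult_def mat_def vec_eq_iff if_distrib if_distribR sum.delta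
      cong: if_cong)

text \<open>Scalar matrices commute with \<open>P\<close>, so the intertwining relation passes to
  \<open>mat l - A\<close>; then \<open>det P\<close> cancels.\<close>

lemma det_mat_minus_similar:
  fixes A P M :: "'a::field ^ 'n ^ 'n"
  assumes "A ** P = P ** M" "invertible P"
  shows "det (mat l - A) = det (mat l - M)"
proof -
  have "(mat l - A) ** P = P ** (mat l - M)"
    using assms(1) mat_mult_commute[of l P] 
    by (simp add: vec_eq_iff matrix_matrix_mult_def left_diff_distrib right_diff_distrib sum_subtractf)
  then have "det (mat l - A) * det P = det P * det (mat l - M)"
    by (metis det_mul)
  then show ?thesis
    using assms(2) by (simp add: invertible_det_nz)
qed

lemma eigenvalues_eq_det:
  fixes A :: "'a::field ^ 'n ^ 'n"
  shows "eigenvalues A = {l. det (mat l - A) = 0}"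
proof -
  have "(\<exists>v. eigenvector A v l) \<longleftrightarrow> det (mat l - A) = 0" for l
  proof -
    have "mat l *v v = l *s v" for v :: "'a ^ 'n"
      by (simp add: matrix_vector_mult_def mat_def vec_eq_iff if_distrib if_distribR cong: if_cong)
    then have "(mat l - A) *v v = 0 \<longleftrightarrow> A *v v = l *s v" for v
      by (auto simp: matrix_vector_mult_diff_rdistrib)
    then show ?thesis
      using invertible_det_nz[of "mat l - A"]
      unfolding invertible_left_inverse matrix_left_invertible_ker eigenvector_def by auto
  qed
  then show ?thesis
    by (simp add: eigenvalues_def)
qed

lemma diagonalizable_similar:
  fixes A P M :: "'a::field ^ 'n ^ 'n"
  assumes "A ** P = P ** M" "invertible P" "\<And>i j. i \<noteq> j \<Longrightarrow> M $ i $ j = 0"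
  shows "diagonalizable A"
proof -
  have "A = P ** M ** matrix_inv P"
    by (metis assms(1,2) matrix_inv_inverse(1) matrix_mul_assoc matrix_mul_rid)
  then show ?thesis
    unfolding diagonalizable_def using assms(2,3) by blast
qed

text \<open>A column entry \<open>n i\<close> is removed by adding a multiple of the eigenvector \<open>axis i 1\<close> to the
  basis vector \<open>axis j 1\<close>, which needs \<open>d i \<noteq> d j\<close> unless \<open>n i\<close> vanishes already; in
  that case the multiple \<open>n i / (d j - d i)\<close> is \<open>0\<close>.\<close>

lemma diagonalizable_similar_arrow_matrix:
  fixes A P :: "'a::field ^ 'n ^ 'n"
  assumes AP: "A ** P = P ** arrow_matrix j d n" and P: "invertible P"
    and nonres: "\<And>i. i \<noteq> j \<Longrightarrow> d i = d j \<Longrightarrow> n i = 0"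
  shows "diagonalizable A"
proof (rule diagonalizable_similar)
  define Q where "Q = arrow_matrix j (\<lambda>_. 1) (\<lambda>i. n i / (d j - d i))"
  define D where "D = arrow_matrix j d (\<lambda>_. 0)"
  have "(arrow_matrix j d n ** Q) *v x = (Q ** D) *v x" for x
  proof -
    \<comment> \<open>Entry \<open>(i, j)\<close> of the identity. At resonance
      \<open>n i = 0\<close>, and the quotient by zero is \<open>0\<close>, so both sides
      vanish.\<close>
    have "d i * (n i / (d j - d i)) + n i = n i / (d j - d i) * d j" if "i \<noteq> j" for i
      using nonres[OF that] by (cases "d i = d j") (auto simp: field_simps)
    then have "n i * x $ j + d i * (n i * x $ j) / (d j - d i) = d j * (n i * x $ j) / (d j - d i)"
      if "i \<noteq> j" for i
      using that by (metis (no_types, opaque_lifting) add.commute distrib_right mult.assoc mult.commute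
          times_divide_eq_right)
    then show ?thesis
      unfolding matrix_vector_mul_assoc[symmetric]
      by (simp add: vec_eq_iff Q_def D_def arrow_matrix_mult_vec algebra_simps)
  qed
  then have "arrow_matrix j d n ** Q = Q ** D"
    by (simp add: matrix_eq)
  then show "A ** (P ** Q) = (P ** Q) ** D"
    by (metis AP matrix_mul_assoc)
  have "invertible Q"
    by (simp add: invertible_det_nz Q_def det_arrow_matrix)
  then show "invertible (P ** Q)"
    by (rule invertible_mult[OF P])
  show "D $ i $ k = 0" if "i \<noteq> k" for i k
    using that by (simp add: D_def arrow_matrix_def)
qed

text \<open>The columns of the diagonalizing matrix are eigenvectors; its invertibility makes them
  nonzero and spanning.\<close>

lemma span_eigenvectors_diagonalizable:
  fixes A :: "real ^ 'n ^ 'n"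
  assumes "diagonalizable A"
  shows "span {r. \<exists>l. eigenvector A r l} = UNIV"
proof -
  obtain P D :: "real ^ 'n ^ 'n" where P: "invertible P" and D: "\<And>i j. i \<noteq> j \<Longrightarrow> D $ i $ j = 0"
    and A: "A = P ** D ** matrix_inv P"
    using assms unfolding diagonalizable_def by blast
  have AP: "A ** P = P ** D"
    by (metis A P matrix_inv_inverse(2) matrix_mul_assoc matrix_mul_rid)
  have "\<exists>l. eigenvector A (column i P) l" for i
  proof -
    have "D *v axis i 1 = D $ i $ i *s axis i 1"
      using D unfolding matrix_vector_mult_basis by (auto simp: column_def vec_eq_iff axis_def)
    then have "A *v column i P = D $ i $ i *s column i P"
      unfolding matrix_vector_mult_basis[symmetric] matrix_vector_mul_assoc AP
      by (simp add: matrix_vector_mul_assoc[symmetric] vector_scalar_commute)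
    moreover have "column i P \<noteq> 0"
      using P inj_matrix_vector_mult[OF P]
      by (metis axis_eq_0_iff injD matrix_vector_mult_0_right matrix_vector_mult_basis zero_neq_one)
    ultimately show ?thesis
      unfolding eigenvector_def by blast
  qed
  then have "columns P \<subseteq> {r. \<exists>l. eigenvector A r l}"
    by (auto simp: columns_def)
  moreover have "span (columns P) = UNIV"
    using P matrix_right_invertible_span_columns[of P] unfolding invertible_def span_vec_eq by blast
  ultimately show ?thesis
    by (metis span_mono top.extremum_uniqueI)
qed

section \<open>Real matrices viewed over the complex numbers\<close>

lemma map_matrix_of_real_mult:
  "map_matrix of_real (A ** B) = map_matrix of_real A ** (map_matrix of_real B :: 'a::{real_field} ^ 'n ^ 'm)"
  by (simp add: vec_eq_iff matrix_matrix_mult_def)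

lemma map_matrix_of_real_arrow_matrix:
  "map_matrix of_real (arrow_matrix j d n) =
     arrow_matrix j (\<lambda>i. of_real (d i)) (\<lambda>i. of_real (n i) :: 'a::real_field)"
  by (simp add: vec_eq_iff arrow_matrix_def)

lemma invertible_map_matrix_of_real:
  assumes "invertible P"
  shows "invertible (map_matrix of_real P :: 'a::real_field ^ 'n ^ 'n)"
proof -
  have "map_matrix of_real (mat 1) = (mat 1 :: 'a ^ 'n ^ 'n)"
    by (simp add: vec_eq_iff mat_def)
  then show ?thesis
    using assms unfolding invertible_right_inverse by (metis map_matrix_of_real_mult)
qed

text \<open>Similarity survives the embedding into the complex numbers, where the characteristic
  polynomial splits into the factors \<open>l - of_real (d i)\<close>; this excludes nonreal
  eigenvalues.\<close>

lemma eigenvalues_similar_arrow_matrix: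
  fixes A P :: "real ^ 'n ^ 'n"
  assumes "A ** P = P ** arrow_matrix j d n" "invertible P"
  shows "eigenvalues (map_matrix complex_of_real A) = complex_of_real ` range d"
proof -
  let ?c = "map_matrix complex_of_real"
  have "?c A ** ?c P = ?c P ** arrow_matrix j (\<lambda>i. of_real (d i)) (\<lambda>i. of_real (n i))"
    by (simp add: assms(1) map_matrix_of_real_mult[symmetric] map_matrix_of_real_arrow_matrix[symmetric])
  from det_mat_minus_similar[OF this invertible_map_matrix_of_real[OF assms(2)]]
  have "det (mat l - ?c A) = (\<Prod>i\<in>UNIV. l - of_real (d i))" for l
    unfolding mat_minus_arrow_matrix det_arrow_matrix .
  then show ?thesis
    unfolding eigenvalues_eq_det by (auto simp: prod_zero_iff)
qed

section \<open>Smooth functions\<close>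

lemma smooth_on_imp_has_derivative:
  assumes "smooth_on S f" "open S" "x \<in> S"
  shows "(f has_derivative frechet_derivative f (at x)) (at x)"
proof -
  have "times_cont_diff (Suc 0) S f"
    using assms(1) unfolding smooth_on_def by blast
  then show ?thesis
    using assms(2,3) by (simp add: differentiable_on_eq_differentiable_at frechet_derivative_works)
qed

lemma smooth_on_frechet_derivative:
  assumes "smooth_on S f"
  shows "smooth_on S (\<lambda>x. frechet_derivative f (at x) v)"
  unfolding smooth_on_def
proof
  fix n
  have "times_cont_diff (Suc n) S f"
    using assms unfolding smooth_on_def by blast
  then show "times_cont_diff n S (\<lambda>x. frechet_derivative f (at x) v)"
    by simp
qed

lemma times_cont_diff_const: "times_cont_diff n S (\<lambda>_. c)"
  by (induction n arbitrary: c) (simp_all add: frechet_derivative_const)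

text \<open>Prepares the affine test fields that pin down the quasilinear matrix: a directional
  derivative is constant.\<close>

lemma smooth_on_affine:
  assumes "bounded_linear f"
  shows "smooth_on S (\<lambda>x. a + f x)"
  unfolding smooth_on_def
proof
  fix n
  have D: "((\<lambda>x. a + f x) has_derivative f) (at x)" for x
    using bounded_linear_imp_has_derivative[OF assms] has_derivative_add[OF has_derivative_const] by fastforce
  then have "frechet_derivative (\<lambda>x. a + f x) (at x) = f" for x
    by (metis frechet_derivative_at)
  moreover have "(\<lambda>x. a + f x) differentiable_on S"
    by (intro differentiable_at_imp_differentiable_on) (rule differentiableI[OF D])
  ultimately show "times_cont_diff n S (\<lambda>x. a + f x)"
    by (cases n) (simp_all add: times_cont_diff_const differentiable_imp_continuous_on)
qed

section \<open>The isentropic derivative of the pressure\<close>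

locale eos =
  fixes U s T p
  assumes complete_eos: "complete_eos U s T p"
begin

lemma open_dom: "open U" and convex_dom: "convex U"
  and spec_vol_pos: "x \<in> U \<Longrightarrow> fst x > 0"
  and temperature_pos: "x \<in> U \<Longrightarrow> T x > 0"
  and entropy_smooth: "smooth_on U s"
  and Gibbs: "x \<in> U \<Longrightarrow> T x * frechet_derivative s (at x) (a, b) = b + p x * a"
  using complete_eos unfolding complete_eos_def strictly_concave_on_def by auto

lemma entropy_deriv:
  assumes "x \<in> U"
  shows "(s has_derivative (\<lambda>h. (snd h + p x * fst h) / T x)) (at x)"
proof -
  have "frechet_derivative s (at x) h = (snd h + p x * fst h) / T x" for h
    using Gibbs[OF assms, of "fst h" "snd h"] temperature_pos[OF assms] by (simp add: field_simps)
  then show ?thesis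
    using smooth_on_imp_has_derivative[OF entropy_smooth open_dom assms] by (metis (no_types, lifting) ext)
qed

text \<open>At fixed volume ds/de = 1/T > 0, and convexity keeps the whole energy segment in
  \<open>U\<close>. This makes the energy selected in \<open>isentropic_pressure\<close>
  unique.\<close>

lemma entropy_inj_energy:
  assumes "(\<tau>, e) \<in> U" "(\<tau>, e') \<in> U" "s (\<tau>, e) = s (\<tau>, e')"
  shows "e = e'"
proof -
  have less: "s (\<tau>, a) < s (\<tau>, b)" if "(\<tau>, a) \<in> U" "(\<tau>, b) \<in> U" "a < b" for a b
  proof (rule DERIV_pos_imp_increasing[OF \<open>a < b\<close>])
    fix x assume "a \<le> x" "x \<le> b"
    then have "x \<in> closed_segment a b"
      by (simp add: closed_segment_eq_real_ivl)
    then have "(\<tau>, x) \<in> closed_segment (\<tau>, a) (\<tau>, b)"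
      by (auto simp: in_segment algebra_simps)
    then have x: "(\<tau>, x) \<in> U"
      using convex_contains_segment convex_dom that(1,2) by blast
    have "((\<lambda>y. s (\<tau>, y)) has_derivative (\<lambda>h. 1 / T (\<tau>, x) * h)) (at x)"
    proof -
      have "(Pair \<tau> has_derivative Pair 0) (at x)"
        by (intro has_derivative_Pair has_derivative_const has_derivative_ident)
      from has_derivative_compose[OF this entropy_deriv[OF x]] show ?thesis
        by simp
    qed
    then have "((\<lambda>y. s (\<tau>, y)) has_real_derivative 1 / T (\<tau>, x)) (at x)"
      unfolding has_field_derivative_def .
    then show "\<exists>y. ((\<lambda>y. s (\<tau>, y)) has_real_derivative y) (at x) \<and> 0 < y"
      using temperature_pos[OF x] by auto
  qed
  show ?thesis
    using less assms by (metis linorder_neq_iff)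
qed

text \<open>The Gibbs identity expresses \<open>p\<close> as a quotient of partial derivatives of \<open>s\<close>.\<close>

lemma pressure_deriv:
  assumes "x \<in> U"
  shows "(p has_derivative frechet_derivative p (at x)) (at x)"
proof -
  let ?D = "\<lambda>v x. frechet_derivative s (at x) v"
  \<comment> \<open>The directions \<open>(0, 1)\<close> and \<open>(1, 0)\<close> give T s_e = 1
    and T s_\<tau> = p; dividing eliminates \<open>T\<close>.\<close>
  have pos: "?D (0, 1) y > 0" and eq: "?D (1, 0) y / ?D (0, 1) y = p y" if "y \<in> U" for y
    using Gibbs[OF that, of 0 1] Gibbs[OF that, of 1 0] temperature_pos[OF that]
    by (metis add_0 add_0_right mult_zero_right mult_1_right nonzero_mult_div_cancel_left
        mult_divide_mult_cancel_left less_irrefl zero_less_mult_pos zero_less_one)+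
  have "?D v differentiable (at x)" for v
    using smooth_on_imp_has_derivative[OF smooth_on_frechet_derivative[OF entropy_smooth] open_dom assms]
    by (rule differentiableI)
  then have "(\<lambda>y. ?D (1, 0) y / ?D (0, 1) y) differentiable (at x)"
    using pos[OF assms] by (intro differentiable_divide) auto
  then obtain p' where "((\<lambda>y. ?D (1, 0) y / ?D (0, 1) y) has_derivative p') (at x)"
    unfolding differentiable_def by blast
  then have "(p has_derivative p') (at x)"
    by (rule has_derivative_transform_within_open[OF _ open_dom assms eq])
  then show ?thesis
    using differentiableI frechet_derivative_works by blast
qed

text \<open>\<open>(\<tau>, e) \<mapsto> (\<tau>, s)\<close> is injective on \<open>U\<close>, so its inverse is defined near the image of \<open>x\<close>
  and differentiable there; along an isentrope \<open>de = -p d\<tau>\<close>.\<close>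

lemma dp_drho_at_constant_entropy_eq:
  assumes "x \<in> U"
  shows "dp_drho_at_constant_entropy U s p x =
    (fst x)\<^sup>2 * (p x * frechet_derivative p (at x) (0, 1) - frechet_derivative p (at x) (1, 0))"
proof -
  obtain \<tau> e where x: "x = (\<tau>, e)"
    by (cases x)
  have \<tau>: "\<tau> > 0"
    using spec_vol_pos[OF assms] x by simp
  define F where "F = (\<lambda>y. (fst y, s y))"
  define G where "G = inv_into U F"
  define F' where "F' = (\<lambda>h. (fst h, (snd h + p x * fst h) / T x))"
  \<comment> \<open>Inverse of \<open>F'\<close>: the Gibbs identity solved for de = T ds - p
    d\<tau>.\<close>
  define G' where "G' = (\<lambda>k. (fst k, T x * snd k - p x * fst k))"
  have inj: "inj_on F U"
    using entropy_inj_energy by (auto simp: inj_on_def F_def)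
  have "continuous_on U s"
    using entropy_deriv open_dom by (meson continuous_at_imp_continuous_on has_derivative_continuous)
  then have contF: "continuous_on U F"
    unfolding F_def by (intro continuous_intros)
  have GF: "G (F y) = y" if "y \<in> U" for y
    using that inj by (simp add: G_def)
  have "(F has_derivative F') (at x)"
    unfolding F_def F'_def by (intro has_derivative_Pair entropy_deriv assms has_derivative_fst has_derivative_ident)
  moreover have "F' \<circ> G' = id"
    using temperature_pos[OF assms] by (auto simp: F'_def G'_def fun_eq_iff)
  ultimately have derG: "(G has_derivative G') (at (F x))"
    using has_derivative_inverse_strong[OF open_dom assms contF GF] by blast
  \<comment> \<open>Openness of the image lets the isentrope through \<open>x\<close> continue to
    all densities near \<open>1 / \<tau>\<close>.\<close>
  have openFU: "open (F ` U)"
    using invariance_of_domain[OF contF open_dom inj] .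
  define c where "c = (\<lambda>r::real. (1 / r, s x))"
  have c0: "c (1 / \<tau>) = F x"
    by (simp add: c_def F_def x)
  define N where "N = c -` (F ` U) \<inter> {0<..}"
  have "continuous_on {0<..} c"
    unfolding c_def by (intro continuous_intros) auto
  then have openN: "open N"
    unfolding N_def using openFU by (subst Int_commute) (rule continuous_open_preimage; simp)
  have "1 / \<tau> \<in> N"
    using \<tau> assms c0 by (auto simp: N_def)
  have iso: "p (G (c r)) = isentropic_pressure U s p (s x) r" if r: "r \<in> N" for r
  proof -
    obtain y where y: "y \<in> U" "c r = F y"
      using r unfolding N_def by blast
    obtain a b where ab: "y = (a, b)"
      by (cases y)
    have "a = 1 / r" "s (1 / r, b) = s x" "(1 / r, b) \<in> U"
      using y by (auto simp: c_def F_def ab)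
    then have "(THE e. (1 / r, e) \<in> U \<and> s (1 / r, e) = s x) = b"
      by (intro the_equality) (auto dest: entropy_inj_energy)
    then show ?thesis
      using y GF \<open>a = 1 / r\<close> by (simp add: isentropic_pressure_def ab)
  qed
  let ?Dp = "frechet_derivative p (at x)"
  have "(c has_derivative (\<lambda>h. (- \<tau>\<^sup>2 * h, 0))) (at (1 / \<tau>))"
    unfolding c_def using \<tau>
    by (auto intro!: derivative_eq_intros has_derivative_Pair simp: power2_eq_square field_simps)
  then have "((\<lambda>r. G (c r)) has_derivative (\<lambda>h. G' (- \<tau>\<^sup>2 * h, 0))) (at (1 / \<tau>))"
    using has_derivative_compose derG c0 by metis
  moreover have "G (c (1 / \<tau>)) = x"
    by (simp add: c0 GF assms)
  ultimately have "((\<lambda>r. p (G (c r))) has_derivative (\<lambda>h. ?Dp (G' (- \<tau>\<^sup>2 * h, 0)))) (at (1 / \<tau>))"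
    using has_derivative_compose pressure_deriv[OF assms] by metis
  then have "(isentropic_pressure U s p (s x) has_derivative (\<lambda>h. ?Dp (G' (- \<tau>\<^sup>2 * h, 0)))) (at (1 / \<tau>))"
    by (rule has_derivative_transform_within_open[OF _ openN \<open>1 / \<tau> \<in> N\<close> iso])
  moreover have "?Dp (G' (- \<tau>\<^sup>2 * h, 0)) = \<tau>\<^sup>2 * (p x * ?Dp (0, 1) - ?Dp (1, 0)) * h" for h
  proof -
    have lin: "linear ?Dp"
      using pressure_deriv[OF assms] by (rule has_derivative_linear)
    have "G' (- \<tau>\<^sup>2 * h, 0) = (- \<tau>\<^sup>2 * h) *\<^sub>R (1, 0) + (\<tau>\<^sup>2 * p x * h) *\<^sub>R (0, 1)"
      by (simp add: G'_def)
    then show ?thesis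
      by (simp only: linear_add[OF lin] linear_cmul[OF lin]) (simp add: algebra_simps)
  qed
  ultimately have "(isentropic_pressure U s p (s x) has_real_derivative
      \<tau>\<^sup>2 * (p x * ?Dp (0, 1) - ?Dp (1, 0))) (at (1 / \<tau>))"
    by (simp add: has_field_derivative_def)
  then show ?thesis
    by (simp add: dp_drho_at_constant_entropy_def x DERIV_imp_deriv)
qed

end

section \<open>The system in the physical variables\<close>

lemma exhaust_7:
  fixes i :: 7
  shows "i = 1 \<or> i = 2 \<or> i = 3 \<or> i = 4 \<or> i = 5 \<or> i = 6 \<or> i = 7"
proof (induct i)
  case (of_int z)
  \<comment> \<open>Residues run from 0 to 6; the index \<open>7\<close> is the residue
    \<open>0\<close>.\<close>
  then have "z = 0 \<or> z = 1 \<or> z = 2 \<or> z = 3 \<or> z = 4 \<or> z = 5 \<or> z = 6"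
    by fastforce
  then show ?case
    by auto
qed

lemma UNIV_7: "UNIV = {1, 2, 3, 4, 5, 6, 7 :: 7}"
  using exhaust_7 by auto

lemma prod_7: "prod f (UNIV :: 7 set) = f 1 * f 2 * f 3 * f 4 * f 5 * f 6 * f 7"
  unfolding UNIV_7 by (simp add: ac_simps)

lemma UNIV_phase: "UNIV = {Ph1, Ph2}"
  using phase.exhaust by auto

lemma all_phase: "(\<forall>k. Q k) \<longleftrightarrow> Q Ph1 \<and> Q Ph2"
  by (metis phase.exhaust)

definition state_of ::
  "real \<Rightarrow> (phase \<Rightarrow> real) \<Rightarrow> (phase \<Rightarrow> real) \<Rightarrow> (phase \<Rightarrow> real) \<Rightarrow> state" where
  "state_of a r v e = (\<chi> i. if i = 1 then a else if i = 2 then r Ph1 else if i = 3 then r Ph2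
     else if i = 4 then v Ph1 else if i = 5 then v Ph2 else if i = 6 then e Ph1 else e Ph2)"

lemma state_of_simps [simp]:
  "state_of a r v e $ 1 = a"
  "density k (state_of a r v e) = r k"
  "velocity k (state_of a r v e) = v k"
  "int_energy k (state_of a r v e) = e k"
  by (cases k; simp add: state_of_def)+

lemma state_eq_iff:
  "V = V' \<longleftrightarrow> V $ 1 = V' $ 1 \<and>
    (\<forall>k. density k V = density k V' \<and> velocity k V = velocity k V' \<and> int_energy k V = int_energy k V')"
proof -
  have "V = V' \<longleftrightarrow> (\<forall>i\<in>UNIV. V $ i = V' $ i)"
    by (simp add: vec_eq_iff)
  then show ?thesis
    unfolding UNIV_7 by (auto simp: all_phase)
qed

text \<open>\<open>density\<close>, \<open>velocity\<close> and \<open>int_energy\<close> are linear, so they also read off the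
  components of an increment of the state.\<close>

lemma component_linear [simp]:
  "density k (V + V') = density k V + density k V'"
  "velocity k (V + V') = velocity k V + velocity k V'"
  "int_energy k (V + V') = int_energy k V + int_energy k V'"
  "density k (x *\<^sub>R V) = x * density k V"
  "velocity k (x *\<^sub>R V) = x * velocity k V"
  "int_energy k (x *\<^sub>R V) = x * int_energy k V"
  "density k 0 = 0" "velocity k 0 = 0" "int_energy k 0 = 0"
  by (cases k; simp)+

text \<open>The derivative of \<open>vol_frac k\<close> in alpha_1; it also absorbs the opposite
  signs of the exchange terms of the two phases.\<close>

fun vol_sign :: "phase \<Rightarrow> real" where
  "vol_sign Ph1 = 1"
| "vol_sign Ph2 = - 1"

text \<open>Taken at constant internal energy, not constant entropy; the factor comes from d\<tau> =
  - d\<rho> / \<rho>^2.\<close>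

definition dp_drho :: "(phase \<Rightarrow> real \<times> real \<Rightarrow> real) \<Rightarrow> phase \<Rightarrow> state \<Rightarrow> real" where
  "dp_drho p k V = - frechet_derivative (p k) (at (thermo k V)) (1, 0) / (density k V)\<^sup>2"

definition dp_de :: "(phase \<Rightarrow> real \<times> real \<Rightarrow> real) \<Rightarrow> phase \<Rightarrow> state \<Rightarrow> real" where
  "dp_de p k V = frechet_derivative (p k) (at (thermo k V)) (0, 1)"

definition pressure_diff :: "(phase \<Rightarrow> real \<times> real \<Rightarrow> real) \<Rightarrow> phase \<Rightarrow> state \<Rightarrow> state \<Rightarrow> real" where
  "pressure_diff p k V b = dp_drho p k V * density k b + dp_de p k V * int_energy k b"

text \<open>Minus the time derivative of the state when \<open>b\<close> is its space derivative.
  The factors \<open>v k - u\<close> arise from replacing the time derivative of the volume fraction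
  by \<open>- u\<close> times its space derivative.\<close>

definition transport :: "(phase \<Rightarrow> real \<times> real \<Rightarrow> real) \<Rightarrow> state \<Rightarrow> state \<Rightarrow> state" where
  "transport p V b =
     (let u = mix_velocity V; \<alpha> = (\<lambda>k. vol_frac k V); \<rho> = (\<lambda>k. density k V);
          v = (\<lambda>k. velocity k V); P = (\<lambda>k. pressure p k V); \<delta> = (\<lambda>k. vol_sign k * b $ 1)
      in state_of (u * b $ 1)
        (\<lambda>k. v k * density k b + \<rho> k * velocity k b + \<rho> k * (v k - u) / \<alpha> k * \<delta> k)
        (\<lambda>k. v k * velocity k b + pressure_diff p k V b / \<rho> k
             + (P k - interface_pressure p V) / (\<alpha> k * \<rho> k) * \<delta> k)
        (\<lambda>k. v k * int_energy k b + P k / \<rho> k * velocity k b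
             + P k * (v k - u) / (\<alpha> k * \<rho> k) * \<delta> k))"

lemma linear_transport: "linear (transport p V)"
  by (rule linearI)
    (simp_all add: state_eq_iff transport_def Let_def pressure_diff_def divide_inverse algebra_simps)

lemma component_has_derivative:
  assumes "(\<phi> has_derivative \<phi>') (at z)"
  shows "((\<lambda>z. vol_frac k (\<phi> z)) has_derivative (\<lambda>h. vol_sign k * \<phi>' h $ 1)) (at z)"
    and "((\<lambda>z. density k (\<phi> z)) has_derivative (\<lambda>h. density k (\<phi>' h))) (at z)"
    and "((\<lambda>z. velocity k (\<phi> z)) has_derivative (\<lambda>h. velocity k (\<phi>' h))) (at z)"
    and "((\<lambda>z. int_energy k (\<phi> z)) has_derivative (\<lambda>h. int_energy k (\<phi>' h))) (at z)"
proof -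
  have nth: "((\<lambda>z. \<phi> z $ i) has_derivative (\<lambda>h. \<phi>' h $ i)) (at z)" for i
    by (rule bounded_linear.has_derivative[OF bounded_linear_vec_nth assms])
  show "((\<lambda>z. vol_frac k (\<phi> z)) has_derivative (\<lambda>h. vol_sign k * \<phi>' h $ 1)) (at z)"
    using nth[of 1] has_derivative_diff[OF has_derivative_const nth[of 1]] by (cases k) simp_all
  show "((\<lambda>z. density k (\<phi> z)) has_derivative (\<lambda>h. density k (\<phi>' h))) (at z)"
    "((\<lambda>z. velocity k (\<phi> z)) has_derivative (\<lambda>h. velocity k (\<phi>' h))) (at z)"
    "((\<lambda>z. int_energy k (\<phi> z)) has_derivative (\<lambda>h. int_energy k (\<phi>' h))) (at z)"
    by (cases k; simp add: nth)+
qed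

locale regular_state =
  fixes p :: "phase \<Rightarrow> real \<times> real \<Rightarrow> real" and V :: state
  assumes vol_frac_pos: "vol_frac k V > 0"
    and density_pos: "density k V > 0"
    and pressure_differentiable:
      "(p k has_derivative frechet_derivative (p k) (at (thermo k V))) (at (thermo k V))"
begin

lemma part_density_pos: "part_density k V > 0"
  by (simp add: part_density_def vol_frac_pos density_pos)

lemma mass_frac_sum: "mass_frac Ph1 V + mass_frac Ph2 V = 1"
  using part_density_pos[of Ph1] part_density_pos[of Ph2]
  by (simp add: mass_frac_def mix_density_def flip: add_divide_distrib)

text \<open>For phase 1 both sides equal Y_2 p_1 (u_1 - u_2), because Y_1 + Y_2 = 1; phase 2 is
  symmetric.\<close>

lemma interface_pressure_work:
  "interface_pressure p V * velocity k V - interface_work p V =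
     pressure p k V * (velocity k V - mix_velocity V)"
proof -
  have Y: "mass_frac Ph2 V = 1 - mass_frac Ph1 V"
    using mass_frac_sum by simp
  show ?thesis
    by (cases k) (simp_all add: interface_pressure_def interface_work_def mix_velocity_def Y algebra_simps)
qed

lemma pressure_has_derivative:
  assumes "(\<phi> has_derivative \<phi>') (at z)" "\<phi> z = V"
  shows "((\<lambda>z. pressure p k (\<phi> z)) has_derivative (\<lambda>h. pressure_diff p k V (\<phi>' h))) (at z)"
proof -
  let ?P = "frechet_derivative (p k) (at (thermo k V))"
  have "((\<lambda>z. thermo k (\<phi> z)) has_derivative
      (\<lambda>h. (- density k (\<phi>' h) / (density k V)\<^sup>2, int_energy k (\<phi>' h)))) (at z)"
    unfolding thermo_def using density_pos[of k]
    by (intro has_derivative_eq_rhs[OF has_derivative_Pair[OF has_derivative_divide'[OF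
            has_derivative_const component_has_derivative(2)[OF assms(1)]]
          component_has_derivative(4)[OF assms(1)]]])
      (simp_all add: assms(2) power2_eq_square)
  then have "((\<lambda>z. p k (thermo k (\<phi> z))) has_derivative
      (\<lambda>h. ?P (- density k (\<phi>' h) / (density k V)\<^sup>2, int_energy k (\<phi>' h)))) (at z)"
    by (rule has_derivative_compose) (unfold assms(2), rule pressure_differentiable)
  moreover have "?P (- density k b / (density k V)\<^sup>2, int_energy k b) = pressure_diff p k V b" for b
  proof -
    have lin: "linear ?P"
      using pressure_differentiable by (rule has_derivative_linear)
    have "(- density k b / (density k V)\<^sup>2, int_energy k b) =
        (- density k b / (density k V)\<^sup>2) *\<^sub>R (1, 0) + int_energy k b *\<^sub>R (0, 1)"
      by simp
    then show ?thesis
      by (simp only: linear_add[OF lin] linear_cmul[OF lin])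
        (simp add: pressure_diff_def dp_drho_def dp_de_def)
  qed
  ultimately show ?thesis
    by (simp add: pressure_def)
qed

end

lemma Dt_eq: "(f has_derivative f') (at z) \<Longrightarrow> Dt f z = f' (1, 0)"
  and Dx_eq: "(f has_derivative f') (at z) \<Longrightarrow> Dx f z = f' (0, 1)"
  unfolding Dt_def Dx_def by (metis frechet_derivative_at)+

context regular_state
begin

text \<open>Once the volume fraction equation is imposed, the conservative residuals of a phase are
  a triangular combination of the primitive ones, with nonzero diagonal entries \<alpha>, \<alpha>
  \<rho>, \<alpha> \<rho>.\<close>

lemma two_fluid_system_at_iff:
  assumes \<phi>: "(\<phi> has_derivative \<phi>') (at z)" and V: "\<phi> z = V"
  shows "two_fluid_system_at p \<phi> z \<longleftrightarrow> \<phi>' (1, 0) + transport p V (\<phi>' (0, 1)) = 0"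
proof -
  define a b where "a = \<phi>' (1, 0)" and "b = \<phi>' (0, 1)"
  define u where "u = mix_velocity V"
  define pI where "pI = interface_pressure p V"
  define W where "W = interface_work p V"
  define \<delta> where "\<delta> = (\<lambda>k b :: state. vol_sign k * b $ 1)"
  define \<alpha> \<rho> v e P
    where "\<alpha> = (\<lambda>k. vol_frac k V)" and "\<rho> = (\<lambda>k. density k V)" and "v = (\<lambda>k. velocity k V)"
      and "e = (\<lambda>k. int_energy k V)" and "P = (\<lambda>k. pressure p k V)"
  note fold_defs = \<alpha>_def[THEN fun_cong, symmetric] \<rho>_def[THEN fun_cong, symmetric]
    v_def[THEN fun_cong, symmetric] e_def[THEN fun_cong, symmetric] P_def[THEN fun_cong, symmetric]
  have [simp]: "\<alpha> k \<noteq> 0" "\<rho> k \<noteq> 0" for k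
    using vol_frac_pos[of k] density_pos[of k] by (auto simp: \<alpha>_def \<rho>_def)
  have vol: "((\<lambda>z. vol_frac k (\<phi> z)) has_derivative (\<lambda>h. \<delta> k (\<phi>' h))) (at z)" for k
    using component_has_derivative(1)[OF \<phi>] by (simp add: \<delta>_def)
  note dens = component_has_derivative(2)[OF \<phi>]
    and vel = component_has_derivative(3)[OF \<phi>]
    and ener = component_has_derivative(4)[OF \<phi>]
    and pres = pressure_has_derivative[OF \<phi> V]
  define dm where "dm = (\<lambda>k h. \<delta> k h * \<rho> k + \<alpha> k * density k h)"
  define E where "E = (\<lambda>k. e k + (v k)\<^sup>2 / 2)"
  define dE where "dE = (\<lambda>k h. int_energy k h + v k * velocity k h)"
  define H where "H = (\<lambda>k. E k + P k / \<rho> k)"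
  define dH where "dH = (\<lambda>k h. dE k h + pressure_diff p k V h / \<rho> k - P k * density k h / (\<rho> k)\<^sup>2)"
  have mass: "((\<lambda>z. part_density k (\<phi> z)) has_derivative (\<lambda>h. dm k (\<phi>' h))) (at z)" for k
    unfolding part_density_def
    by (auto intro!: derivative_eq_intros vol dens simp: V fold_defs dm_def fun_eq_iff algebra_simps)
  have energy: "((\<lambda>z. total_energy k (\<phi> z)) has_derivative (\<lambda>h. dE k (\<phi>' h))) (at z)" for k
    unfolding total_energy_def
    by (auto intro!: derivative_eq_intros vel ener simp: V fold_defs dE_def fun_eq_iff)
  have enthalpy: "((\<lambda>z. total_enthalpy p k (\<phi> z)) has_derivative (\<lambda>h. dH k (\<phi>' h))) (at z)" for k
    unfolding total_enthalpy_def
    by (rule has_derivative_eq_rhs[OF has_derivative_add[OF energy has_derivative_divide'[OF pres dens]]])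
      (simp_all add: V fold_defs dH_def fun_eq_iff power2_eq_square diff_divide_distrib)
  have m: "part_density k V = \<alpha> k * \<rho> k" "total_energy k V = E k"
    "total_enthalpy p k V = H k" for k
    by (simp_all add: V fold_defs part_density_def total_energy_def total_enthalpy_def E_def H_def)
  define mass_res where "mass_res = (\<lambda>k. dm k a + dm k b * v k + \<alpha> k * \<rho> k * velocity k b)"
  define mom_res where "mom_res = (\<lambda>k. dm k a * v k + \<alpha> k * \<rho> k * velocity k a
      + dm k b * (v k)\<^sup>2 + \<alpha> k * \<rho> k * (2 * v k * velocity k b)
      + \<delta> k b * P k + \<alpha> k * pressure_diff p k V b - pI * \<delta> k b)"
  define en_res where "en_res = (\<lambda>k. dm k a * E k + \<alpha> k * \<rho> k * dE k a
      + (dm k b * H k + \<alpha> k * \<rho> k * dH k b) * v k + \<alpha> k * \<rho> k * H k * velocity k b - W * \<delta> k b)"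
  have vol_eq: "Dt (\<lambda>z. vol_frac k (\<phi> z)) z = \<delta> k a" "Dx (\<lambda>z. vol_frac k (\<phi> z)) z = \<delta> k b" for k
    using Dt_eq[OF vol] Dx_eq[OF vol] by (simp_all add: a_def b_def)
  have mass_eq: "Dt (\<lambda>z. part_density k (\<phi> z)) z
      + Dx (\<lambda>z. part_density k (\<phi> z) * velocity k (\<phi> z)) z = mass_res k" for k
    using Dt_eq[OF mass, of k] Dx_eq[OF has_derivative_mult[OF mass vel], of k k]
    by (simp add: V m fold_defs mass_res_def a_def b_def)
  have mom_eq: "Dt (\<lambda>z. part_density k (\<phi> z) * velocity k (\<phi> z)) z
      + Dx (\<lambda>z. part_density k (\<phi> z) * (velocity k (\<phi> z))\<^sup>2 + vol_frac k (\<phi> z) * pressure p k (\<phi> z)) z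
      = mom_res k + pI * \<delta> k b" for k
    using Dt_eq[OF has_derivative_mult[OF mass vel], of k k]
      Dx_eq[OF has_derivative_add[OF has_derivative_mult[OF mass has_derivative_power[OF vel]]
          has_derivative_mult[OF vol pres]], of k k 2 k k]
    by (simp add: V m fold_defs mom_res_def a_def b_def algebra_simps)
  have en_eq: "Dt (\<lambda>z. part_density k (\<phi> z) * total_energy k (\<phi> z)) z
      + Dx (\<lambda>z. part_density k (\<phi> z) * total_enthalpy p k (\<phi> z) * velocity k (\<phi> z)) z
      = en_res k + W * \<delta> k b" for k
    using Dt_eq[OF has_derivative_mult[OF mass energy], of k k]
      Dx_eq[OF has_derivative_mult[OF has_derivative_mult[OF mass enthalpy] vel], of k k k]
    by (simp add: V m fold_defs en_res_def a_def b_def algebra_simps)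
  have system: "two_fluid_system_at p \<phi> z \<longleftrightarrow>
      a $ 1 + u * b $ 1 = 0 \<and> (\<forall>k. mass_res k = 0 \<and> mom_res k = 0 \<and> en_res k = 0)"
    unfolding two_fluid_system_at_def Let_def vol_eq mass_eq mom_eq en_eq all_phase
    by (auto simp: V \<delta>_def simp flip: u_def pI_def W_def)
  define R1 where "R1 = (\<lambda>k. density k a + v k * density k b + \<rho> k * velocity k b
      + \<rho> k * (v k - u) / \<alpha> k * \<delta> k b)"
  define R2 where "R2 = (\<lambda>k. velocity k a + v k * velocity k b + pressure_diff p k V b / \<rho> k
      + (P k - pI) / (\<alpha> k * \<rho> k) * \<delta> k b)"
  define R3 where "R3 = (\<lambda>k. int_energy k a + v k * int_energy k b + P k / \<rho> k * velocity k b
      + P k * (v k - u) / (\<alpha> k * \<rho> k) * \<delta> k b)"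
  have phase: "mass_res k = 0 \<and> mom_res k = 0 \<and> en_res k = 0 \<longleftrightarrow> R1 k = 0 \<and> R2 k = 0 \<and> R3 k = 0"
    if "a $ 1 + u * b $ 1 = 0" for k
  proof -
    have "a $ 1 = - u * b $ 1"
      using that by simp
    then have \<delta>a: "\<delta> k a = - u * \<delta> k b"
      by (simp add: \<delta>_def)
    \<comment> \<open>Splits the interfacial work into the work of \<open>pI\<close>, accounted for
      by the momentum residual, and the source in \<open>R3\<close>.\<close>
    have W: "W = pI * v k - P k * (v k - u)"
      using interface_pressure_work[of k] by (simp add: W_def pI_def P_def v_def u_def)
    have 1: "mass_res k = \<alpha> k * R1 k"
      by (simp add: mass_res_def R1_def dm_def \<delta>a field_simps)
    have 2: "mom_res k = \<alpha> k * \<rho> k * R2 k + v k * mass_res k"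
      by (simp add: mom_res_def mass_res_def R2_def field_simps power2_eq_square)
    have 3: "en_res k = \<alpha> k * \<rho> k * R3 k + \<alpha> k * \<rho> k * v k * R2 k + E k * mass_res k"
      by (simp add: en_res_def mass_res_def R3_def R2_def dE_def dH_def H_def W dm_def field_simps power2_eq_square)
    show ?thesis
      unfolding 3 2 1 by auto
  qed
  have "a + transport p V b = 0 \<longleftrightarrow>
      a $ 1 + u * b $ 1 = 0 \<and> (\<forall>k. R1 k = 0 \<and> R2 k = 0 \<and> R3 k = 0)"
    by (simp add: state_eq_iff transport_def Let_def R1_def R2_def R3_def \<alpha>_def \<rho>_def v_def P_def
        \<delta>_def u_def pI_def add.assoc)
  then show ?thesis
    using system phase by (auto simp flip: a_def b_def)
qed

end

section \<open>The eigenbasis\<close>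

lemma state_of_nth:
  "state_of a r v e $ 1 = a" "state_of a r v e $ 2 = r Ph1" "state_of a r v e $ 3 = r Ph2"
  "state_of a r v e $ 4 = v Ph1" "state_of a r v e $ 5 = v Ph2"
  "state_of a r v e $ 6 = e Ph1" "state_of a r v e $ 7 = e Ph2"
  by (simp_all add: state_of_def)

lemma arrow_matrix_state_of:
  "arrow_matrix 1 (($) (state_of a r v e)) (($) (state_of a' r' v' e')) *v y =
     state_of (a * y $ 1) (\<lambda>k. r k * density k y + r' k * y $ 1)
       (\<lambda>k. v k * velocity k y + v' k * y $ 1) (\<lambda>k. e k * int_energy k y + e' k * y $ 1)"
proof -
  let ?M = "arrow_matrix 1 (($) (state_of a r v e)) (($) (state_of a' r' v' e'))"
  have "density k (?M *v y) = r k * density k y + r' k * y $ 1"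
    "velocity k (?M *v y) = v k * velocity k y + v' k * y $ 1"
    "int_energy k (?M *v y) = e k * int_energy k y + e' k * y $ 1" for k
    by (cases k; simp add: arrow_matrix_mult_vec state_of_nth)+
  then show ?thesis
    by (simp add: state_eq_iff arrow_matrix_mult_vec)
qed

text \<open>\<open>c_sq\<close> is the isentropic derivative of the pressure, expanded by the chain
  rule along de = (p / \<rho>^2) d\<rho>.\<close>

locale sound_state = regular_state +
  fixes c :: "phase \<Rightarrow> real"
  assumes c_pos: "c k > 0"
    and c_sq: "(c k)\<^sup>2 = dp_drho p k V + pressure p k V * dp_de p k V / (density k V)\<^sup>2"
begin

text \<open>In the coordinates \<open>y\<close> the increments \<open>density k y\<close>, \<open>velocity k y\<close> and \<open>int_energy k y\<close> are
  the amplitudes of the waves of speeds \<open>v k + c k\<close>, \<open>v k - c k\<close> and \<open>v k\<close>: in an acoustic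
  wave \<open>de = p / \<rho>\<^sup>2 d\<rho>\<close>, and in an entropy wave \<open>dp = 0\<close>.\<close>

definition wave_map :: "state \<Rightarrow> state" where
  "wave_map y = state_of (y $ 1)
     (\<lambda>k. density k V * (density k y + velocity k y) + dp_de p k V * int_energy k y)
     (\<lambda>k. c k * (density k y - velocity k y))
     (\<lambda>k. pressure p k V / density k V * (density k y + velocity k y) - dp_drho p k V * int_energy k y)"

definition speeds :: state where
  "speeds = state_of (mix_velocity V) (\<lambda>k. velocity k V + c k) (\<lambda>k. velocity k V - c k)
     (\<lambda>k. velocity k V)"

text \<open>Acoustic amplitudes excited by a unit change of alpha_1: their sum matches the density
  source of \<open>transport\<close> divided by the density, and \<open>c k\<close> times their
  difference matches the velocity source. \<open>\<sigma>\<close> is 1 or -1, the sign of the half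
  difference.\<close>

definition coupling :: "real \<Rightarrow> phase \<Rightarrow> real" where
  "coupling \<sigma> k = vol_sign k / 2 * ((velocity k V - mix_velocity V) / vol_frac k V
     + \<sigma> * ((pressure p k V - interface_pressure p V) / (vol_frac k V * density k V * c k)))"

text \<open>A change of volume fraction excites acoustic waves only: its source is isentropic.\<close>

definition couplings :: state where
  "couplings = state_of 0 (coupling 1) (coupling (- 1)) (\<lambda>_. 0)"

lemma linear_wave_map: "linear wave_map"
  by (rule linearI) (simp_all add: state_eq_iff wave_map_def algebra_simps
      del: times_divide_eq_left times_divide_eq_right)

text \<open>In each phase the velocity component forces equal acoustic amplitudes; density and
  energy then form a 2x2 system, in this amplitude and the entropy amplitude, of determinant - 2
  \<rho> c^2.\<close>

lemma wave_map_eq_0: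
  assumes "wave_map y = 0"
  shows "y = 0"
proof -
  have "density k y = 0 \<and> velocity k y = 0 \<and> int_energy k y = 0" for k
  proof -
    have \<rho>: "density k V > 0"
      by (rule density_pos)
    have "c k * (density k y - velocity k y) = 0"
      and r': "density k V * (density k y + velocity k y) + dp_de p k V * int_energy k y = 0"
      and e': "pressure p k V / density k V * (density k y + velocity k y)
        - dp_drho p k V * int_energy k y = 0"
      using assms unfolding state_eq_iff wave_map_def state_of_simps by simp_all
    then have v: "velocity k y = density k y"
      using c_pos[of k] by simp
    have r: "dp_de p k V * int_energy k y = - (density k V * (2 * density k y))"
      using r' unfolding v mult_2 by linarith
    have e: "dp_drho p k V * int_energy k y = pressure p k V / density k V * (2 * density k y)"
      using e' unfolding v mult_2 by linarith
    have "(c k)\<^sup>2 * int_energy k y =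
        dp_drho p k V * int_energy k y + pressure p k V / (density k V)\<^sup>2 * (dp_de p k V * int_energy k y)"
      by (simp add: c_sq algebra_simps)
    also have "\<dots> = 0"
      unfolding r e using \<rho> by (simp add: field_simps power2_eq_square)
    finally have ie: "int_energy k y = 0"
      using c_pos[of k] by simp
    then show ?thesis
      using r v \<rho> by simp
  qed
  moreover have "y $ 1 = 0"
    using assms by (simp add: state_eq_iff wave_map_def)
  ultimately show ?thesis
    by (simp add: state_eq_iff)
qed

lemma invertible_wave_map: "invertible (matrix wave_map)"
  unfolding invertible_left_inverse matrix_left_invertible_ker
  using linear_wave_map wave_map_eq_0 by (simp add: matrix_vector_mul(2))

lemma transport_wave_map:
  "transport p V (wave_map y) = wave_map (arrow_matrix 1 (($) speeds) (($) couplings) *v y)"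
proof -
  define y' where "y' = arrow_matrix 1 (($) speeds) (($) couplings) *v y"
  define u where "u = mix_velocity V"
  have y': "y' $ 1 = u * y $ 1"
    "density k y' = (velocity k V + c k) * density k y + coupling 1 k * y $ 1"
    "velocity k y' = (velocity k V - c k) * velocity k y + coupling (- 1) k * y $ 1"
    "int_energy k y' = velocity k V * int_energy k y" for k
    by (simp_all add: y'_def speeds_def couplings_def arrow_matrix_state_of u_def)
  have nz: "vol_frac k V \<noteq> 0" "density k V \<noteq> 0" "c k \<noteq> 0" for k
    using vol_frac_pos[of k] density_pos[of k] c_pos[of k] by auto
  have c: "c k * c k = dp_drho p k V + pressure p k V * dp_de p k V / (density k V * density k V)" for k
    using c_sq[of k] by (simp add: power2_eq_square)
  \<comment> \<open>The factors \<open>1 *\<close> and \<open>- 1 *\<close> are kept so that the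
    unfolded couplings match literally.\<close>
  have "\<sigma> / 2 * (x + 1 * z) + \<sigma> / 2 * (x + - 1 * z) = \<sigma> * x" for \<sigma> x z :: real
    by (simp add: field_simps)
  then have sum: "coupling 1 k + coupling (- 1) k = vol_sign k * ((velocity k V - u) / vol_frac k V)" for k
    unfolding coupling_def u_def .
  have diff: "c k * (coupling 1 k - coupling (- 1) k) =
      vol_sign k * (pressure p k V - interface_pressure p V) / (vol_frac k V * density k V)" for k
    using nz by (simp add: coupling_def field_simps)
  have "density k (transport p V (wave_map y)) = density k (wave_map y')"
    "velocity k (transport p V (wave_map y)) = velocity k (wave_map y')"
    "int_energy k (transport p V (wave_map y)) = int_energy k (wave_map y')" for k
  proof -
    let ?v = "velocity k V" and ?a = "density k y" and ?b = "velocity k y" and ?e = "int_energy k y"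
    \<comment> \<open>Density and energy see the acoustic amplitudes only through their sum, and
      their sources have the ratio of an acoustic wave, so the entropy amplitude receives
      none.\<close>
    have acoustic: "density k y' + velocity k y' =
        (?v + c k) * ?a + (?v - c k) * ?b + vol_sign k * ((?v - u) / vol_frac k V) * y $ 1"
      unfolding sum[symmetric] by (simp add: y' algebra_simps)
    show "density k (transport p V (wave_map y)) = density k (wave_map y')"
      unfolding wave_map_def[of y'] state_of_simps acoustic y'(4)
      by (simp add: transport_def Let_def wave_map_def u_def algebra_simps)
    show "int_energy k (transport p V (wave_map y)) = int_energy k (wave_map y')"
      unfolding wave_map_def[of y'] state_of_simps acoustic y'(4) using nz[of k]
      by (simp add: transport_def Let_def wave_map_def u_def field_simps)
    \<comment> \<open>The pressure increment of \<open>wave_map y\<close> is \<rho> c^2 times the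
      sum of the acoustic amplitudes, the entropy part cancelling; \<open>c k * c k\<close> is
      isolated for rewriting.\<close>
    have "velocity k (wave_map y') = ?v * (c k * (?a - ?b)) + (c k * c k) * (?a + ?b)
        + c k * (coupling 1 k - coupling (- 1) k) * y $ 1"
      by (simp add: wave_map_def y' algebra_simps)
    then show "velocity k (transport p V (wave_map y)) = velocity k (wave_map y')"
      unfolding diff c using nz[of k]
      by (simp add: transport_def Let_def wave_map_def pressure_diff_def field_simps)
  qed
  moreover have "transport p V (wave_map y) $ 1 = wave_map y' $ 1"
    by (simp add: transport_def Let_def wave_map_def y' u_def)
  ultimately show ?thesis
    unfolding y'_def by (simp add: state_eq_iff)
qed

lemma transport_matrix_similar:
  "matrix (transport p V) ** matrix wave_map = matrix wave_map ** arrow_matrix 1 (($) speeds) (($) couplings)"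
  unfolding matrix_eq matrix_vector_mul_assoc[symmetric]
  using transport_wave_map linear_wave_map linear_transport by (simp add: matrix_vector_mul(2))

text \<open>The hypotheses exclude equal speeds at the acoustic indices 2 to 5; at the entropy
  indices 6 and 7 the column is zero.\<close>

lemma coupling_nonresonant:
  assumes "\<And>k. mix_velocity V \<noteq> velocity k V + c k" "\<And>k. mix_velocity V \<noteq> velocity k V - c k"
    and "i \<noteq> 1" "speeds $ i = speeds $ 1"
  shows "couplings $ i = 0"
  using exhaust_7[of i] \<open>i \<noteq> 1\<close> assms(4) assms(1,2)[of Ph1, symmetric] assms(1,2)[of Ph2, symmetric]
  by (elim disjE) (simp_all add: speeds_def couplings_def state_of_nth)

lemma range_speeds:
  "range (($) speeds) = {mix_velocity V} \<union>
     (\<Union>k. {velocity k V, velocity k V + c k, velocity k V - c k})"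
  unfolding UNIV_7 UNIV_phase speeds_def image_insert image_empty state_of_nth by blast

lemma prod_speeds:
  "(\<Prod>i\<in>UNIV. l - speeds $ i) =
     (l - mix_velocity V)
       * (l - velocity Ph1 V) * (l - (velocity Ph1 V + c Ph1)) * (l - (velocity Ph1 V - c Ph1))
       * (l - velocity Ph2 V) * (l - (velocity Ph2 V + c Ph2)) * (l - (velocity Ph2 V - c Ph2))"
  unfolding prod_7 speeds_def state_of_nth by (simp only: mult_ac)

end

lemma (in eos) sound_speed_sq:
  assumes "(1 / r, e) \<in> U"
  shows "dp_drho_at_constant_entropy U s p (1 / r, e) =
    - frechet_derivative p (at (1 / r, e)) (1, 0) / r\<^sup>2
      + p (1 / r, e) * frechet_derivative p (at (1 / r, e)) (0, 1) / r\<^sup>2"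
  by (simp add: dp_drho_at_constant_entropy_eq[OF assms] power_divide algebra_simps diff_divide_distrib)

lemma sound_state_admissible:
  assumes eos: "\<And>k. complete_eos (U k) (s k) (T k) (p k)" and V: "V \<in> admissible_states U"
  shows "sound_state p V (\<lambda>k. sound_speed U s p k V)"
proof
  fix k
  interpret eos "U k" "s k" "T k" "p k"
    by unfold_locales (rule eos)
  show "vol_frac k V > 0"
    using V by (cases k) (auto simp: admissible_states_def)
  show "density k V > 0"
    using V by (auto simp: admissible_states_def)
  have U: "thermo k V \<in> U k"
    using V by (auto simp: admissible_states_def)
  show "(p k has_derivative frechet_derivative (p k) (at (thermo k V))) (at (thermo k V))"
    by (rule pressure_deriv[OF U])
  have pos: "dp_drho_at_constant_entropy (U k) (s k) (p k) (thermo k V) > 0"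
    using eos[of k] U by (auto simp: complete_eos_def)
  then show "sound_speed U s p k V > 0"
    by (simp add: sound_speed_def)
  show "(sound_speed U s p k V)\<^sup>2 =
      dp_drho p k V + pressure p k V * dp_de p k V / (density k V)\<^sup>2"
    using pos sound_speed_sq[of "density k V" "int_energy k V"] U
    by (simp add: sound_speed_def dp_drho_def dp_de_def pressure_def thermo_def)
qed

section \<open>The quasilinear matrix\<close>

text \<open>The chain rule puts the Jacobian in front of both derivatives of \<open>q\<close>, and
  cancelling it leaves the conjugated matrix. For uniqueness, affine fields realize every space
  derivative at \<open>w\<close>.\<close>

lemma quasilinear_matrix_iff:
  assumes "open W" "smooth_on W \<Phi>" "w \<in> W" and J: "invertible (jacobian \<Phi> (at w))"
    and "regular_state p (\<Phi> w)"
  shows "quasilinear_matrix p W \<Phi> w A \<longleftrightarrow>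
    A = matrix_inv (jacobian \<Phi> (at w)) ** matrix (transport p (\<Phi> w)) ** jacobian \<Phi> (at w)"
proof -
  interpret regular_state p "\<Phi> w"
    by fact
  let ?J = "jacobian \<Phi> (at w)" and ?B = "matrix (transport p (\<Phi> w))"
  let ?A = "matrix_inv ?J ** ?B ** ?J"
  have \<Phi>: "(\<Phi> has_derivative (\<lambda>h. ?J *v h)) (at w)"
    using smooth_on_imp_has_derivative[OF assms(2,1,3)] differentiableI jacobian_works by blast
  have JA: "?J ** ?A = ?B ** ?J"
    by (simp add: matrix_mul_assoc matrix_inv_inverse(1)[OF J])
  have field: "two_fluid_system_at p (\<Phi> \<circ> q) z \<longleftrightarrow> Dt q z + ?A *v Dx q z = 0"
    if "open \<Omega>" "z \<in> \<Omega>" "smooth_on \<Omega> q" "q z = w" for \<Omega> q z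
  proof -
    have q: "(q has_derivative frechet_derivative q (at z)) (at z)"
      by (rule smooth_on_imp_has_derivative[OF that(3,1,2)])
    have "((\<Phi> \<circ> q) has_derivative (\<lambda>h. ?J *v frechet_derivative q (at z) h)) (at z)"
      using diff_chain_at[OF q] \<Phi> that(4) by (simp add: o_def)
    then have "two_fluid_system_at p (\<Phi> \<circ> q) z \<longleftrightarrow> ?J *v Dt q z + transport p (\<Phi> w) (?J *v Dx q z) = 0"
      unfolding Dt_def Dx_def by (rule two_fluid_system_at_iff) (simp add: that(4))
    also have "transport p (\<Phi> w) (?J *v Dx q z) = ?J *v (?A *v Dx q z)"
      unfolding matrix_vector_mul_assoc JA
      by (simp add: matrix_vector_mul(2) linear_transport flip: matrix_vector_mul_assoc)
    also have "?J *v Dt q z + ?J *v (?A *v Dx q z) = ?J *v (Dt q z + ?A *v Dx q z)"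
      by (simp add: matrix_vector_right_distrib)
    also have "\<dots> = 0 \<longleftrightarrow> Dt q z + ?A *v Dx q z = 0"
      using inj_matrix_vector_mult[OF J] by (metis injD matrix_vector_mult_0_right)
    finally show ?thesis .
  qed
  show ?thesis
  proof
    assume "A = ?A"
    then show "quasilinear_matrix p W \<Phi> w A"
      unfolding quasilinear_matrix_def using field by blast
  next
    assume A: "quasilinear_matrix p W \<Phi> w A"
    have "A *v b = ?A *v b" for b
    proof -
      \<comment> \<open>The time slope is chosen so that the field satisfies the system at the
        origin, which forces \<open>A *v b = ?A *v b\<close>.\<close>
      define f where "f = (\<lambda>y :: real \<times> real. fst y *\<^sub>R (- (?A *v b)) + snd y *\<^sub>R b)"
      define q where "q = (\<lambda>y. w + f y)"
      have f: "bounded_linear f"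
        unfolding f_def by (intro bounded_linear_intros)
      then have q: "(q has_derivative f) (at 0)"
        unfolding q_def using bounded_linear_imp_has_derivative has_derivative_add[OF has_derivative_const]
        by fastforce
      have "continuous_on UNIV q"
        unfolding q_def f_def by (intro continuous_intros)
      then have \<Omega>: "open (q -` W)"
        using \<open>open W\<close> continuous_on_open_vimage[of UNIV q] by auto
      have q0: "q 0 = w"
        by (simp add: q_def f_def)
      have sm: "smooth_on (q -` W) q"
        unfolding q_def by (rule smooth_on_affine[OF f])
      have D: "Dt q 0 = - (?A *v b)" "Dx q 0 = b"
        using Dt_eq[OF q] Dx_eq[OF q] by (simp_all add: f_def)
      have "0 \<in> q -` W"
        using q0 \<open>w \<in> W\<close> by simp
      then have "two_fluid_system_at p (\<Phi> \<circ> q) 0"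
        using field[OF \<Omega> _ sm q0] D by simp
      then have "Dt q 0 + A *v Dx q 0 = 0"
        using A \<Omega> sm q0 \<open>0 \<in> q -` W\<close> unfolding quasilinear_matrix_def by blast
      then show ?thesis
        by (simp add: D)
    qed
    then show "A = ?A"
      by (simp add: matrix_eq)
  qed
qed

theorem proposition4p1:
  fixes U :: "phase \<Rightarrow> (real \<times> real) set"
    and s T p :: "phase \<Rightarrow> real \<times> real \<Rightarrow> real"
    and W :: "(real ^ 7) set" and \<Phi> :: "real ^ 7 \<Rightarrow> state"
    and w :: "real ^ 7" and u :: real and v c :: "phase \<Rightarrow> real"
  assumes eos: "\<And>k. complete_eos (U k) (s k) (T k) (p k)"
    and vars: "state_variables U W \<Phi>" and "w \<in> W"
    and u: "u = mix_velocity (\<Phi> w)"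
    and v: "\<And>k. v k = velocity k (\<Phi> w)"
    and c: "\<And>k. c k = sound_speed U s p k (\<Phi> w)"
  shows "(\<exists>!A. quasilinear_matrix p W \<Phi> w A) \<and>
    (\<forall>A. quasilinear_matrix p W \<Phi> w A \<longrightarrow>
       eigenvalues (map_matrix complex_of_real A) =
         complex_of_real ` ({u} \<union> (\<Union>k. {v k, v k + c k, v k - c k})) \<and>
       (\<forall>l. det (mat l - A) =
          (l - u) * (l - v Ph1) * (l - (v Ph1 + c Ph1)) * (l - (v Ph1 - c Ph1))
                  * (l - v Ph2) * (l - (v Ph2 + c Ph2)) * (l - (v Ph2 - c Ph2))) \<and>
       ((\<forall>k. u \<noteq> v k + c k \<and> u \<noteq> v k - c k) \<longrightarrow>
          span {r. \<exists>l. eigenvector A r l} = UNIV \<and> diagonalizable A))"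
proof -
  let ?J = "jacobian \<Phi> (at w)" and ?B = "matrix (transport p (\<Phi> w))"
  have W: "open W" "smooth_on W \<Phi>" and J: "invertible ?J" and adm: "\<Phi> w \<in> admissible_states U"
    using vars \<open>w \<in> W\<close> unfolding state_variables_def by auto
  have "c = (\<lambda>k. sound_speed U s p k (\<Phi> w))"
    using c by blast
  then interpret sound_state p "\<Phi> w" c
    using sound_state_admissible[OF eos adm] by simp
  note iff = quasilinear_matrix_iff[OF W \<open>w \<in> W\<close> J regular_state_axioms]
  \<comment> \<open>The wave basis in the variables \<open>w\<close>: eigenvectors transform by the
    inverse Jacobian of \<open>\<Phi>\<close>.\<close>
  let ?P = "matrix_inv ?J ** matrix wave_map"
  have "invertible (matrix_inv ?J)"
    using matrix_inv_inverse[OF J] unfolding invertible_def by blast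
  then have P: "invertible ?P"
    by (rule invertible_mult[OF _ invertible_wave_map])
  have AP: "A ** ?P = ?P ** arrow_matrix 1 (($) speeds) (($) couplings)"
    if "quasilinear_matrix p W \<Phi> w A" for A
  proof -
    have "A ** ?P = matrix_inv ?J ** ?B ** (?J ** matrix_inv ?J) ** matrix wave_map"
      using that unfolding iff by (simp add: matrix_mul_assoc)
    also have "\<dots> = matrix_inv ?J ** (?B ** matrix wave_map)"
      by (simp add: matrix_inv_inverse(1)[OF J] matrix_mul_assoc)
    finally show ?thesis
      by (simp add: transport_matrix_similar matrix_mul_assoc)
  qed
  have "\<exists>!A. quasilinear_matrix p W \<Phi> w A"
    by (simp add: iff)
  moreover have "eigenvalues (map_matrix complex_of_real A) =
      complex_of_real ` ({u} \<union> (\<Union>k. {v k, v k + c k, v k - c k}))"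
    if "quasilinear_matrix p W \<Phi> w A" for A
    unfolding eigenvalues_similar_arrow_matrix[OF AP[OF that] P] range_speeds u v ..
  moreover have "det (mat l - A) = (l - u)
      * (l - v Ph1) * (l - (v Ph1 + c Ph1)) * (l - (v Ph1 - c Ph1))
      * (l - v Ph2) * (l - (v Ph2 + c Ph2)) * (l - (v Ph2 - c Ph2))"
    if "quasilinear_matrix p W \<Phi> w A" for A l
    unfolding det_mat_minus_similar[OF AP[OF that] P] mat_minus_arrow_matrix det_arrow_matrix
      prod_speeds u v ..
  moreover have "diagonalizable A"
    if "quasilinear_matrix p W \<Phi> w A" "\<forall>k. u \<noteq> v k + c k \<and> u \<noteq> v k - c k" for A
    using diagonalizable_similar_arrow_matrix[OF AP[OF that(1)] P] coupling_nonresonant that(2)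
    unfolding u v by blast
  ultimately show ?thesis
    using span_eigenvectors_diagonalizable by blast
qed

end
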